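(* Let $\mathbb{K}$ be an algebraically closed field, let $c_1\ge c_2\ge\dots\ge c_m$ and $f_1\ge f_2\ge\dots\ge f_n$ be positive integers, and consider the preinjective Kronecker representations $M^I=\bigoplus_{i=1}^{m}J_{c_i}$ and $N^I=\bigoplus_{j=1}^{n}J_{f_j}$ over $\mathbb{K}$. Let $u_1,v_1,u_2,v_2,\dots,u_w=m,v_w$ be the integers attached to the sequences $(c_i)$ and $(f_j)$. Then $N^I$ is a subrepresentation of $M^I$ if and only if $v_{w-1}=v_w=n$ and, for all $0\le i\le w-2$, $$\sum_{j=v_i+1}^{v_{w-1}}f_j\ \le\sum_{j=u_{i+1}+1}^{u_w}c_j\qquad\text{and}\qquad\sum_{j=v_i+1}^{v_{w-1}}(f_j-1)\ \le\sum_{j=u_{i+1}+1}^{u_w}(c_j-1).$$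
   Context: Representations. A Kronecker representation $(V,W;f,g)$ consists of finite-dimensional $\mathbb{K}$-vector spaces $V,W$ and linear maps $f,g:V\to W$. For $i\ge1$, $J_i=\left(\mathbb{K}^{i},\mathbb{K}^{i-1};\left[\begin{array}{cc}I&0\end{array}\right],\left[\begin{array}{cc}0&I\end{array}\right]\right)$, with $I$ the identity matrix of size $i-1$. Direct sums are taken componentwise. Subrepresentations are considered up to isomorphism: $(V',W';f',g')$ is a subrepresentation of $(V,W;f,g)$ if there are injective linear maps $\phi:V'\to V$ and $\psi:W'\to W$ with $f\phi=\psi f'$ and $g\phi=\psi g'$. Integers $u_l,v_l$. Put $v_0=0$, $f_{n+1}=0$, $c_{m+1}=0$, and let the maximum of an empty set be $0$. For $l=1,2,\dots$ define $$u_l:=\max\{1\le j\le m\mid c_j>f_{v_{l-1}+1}\},\qquad v_l:=\max\{1\le i\le n\mid c_{u_l+1}\le f_i\}.$$ The index $w$ is the first index with $u_w=m$, and the process stops there (after defining $v_w$ by the same formula, so that $v_w=n$ because $c_{m+1}=0$). Empty sums are $0$. *)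

theory Defs
  imports "HOL-Library.Function_Algebras" "HOL-Computational_Algebra.Polynomial"
begin

section \<open>Kronecker representations\<close>

text \<open>
  The spaces of a representation are subspaces of vector spaces given by whole types, so that
  direct sums of arbitrarily many representations stay within the simply typed setting.  The two
  structure maps are only relevant on the left space.
\<close>

record ('k, 'v, 'w) kronecker =
  left_scale :: "'k \<Rightarrow> 'v \<Rightarrow> 'v"
  right_scale :: "'k \<Rightarrow> 'w \<Rightarrow> 'w"
  left_space :: "'v set"
  right_space :: "'w set"
  first_map :: "'v \<Rightarrow> 'w"
  second_map :: "'v \<Rightarrow> 'w"

definition fin_dim_space :: "('k::field \<Rightarrow> 'v::ab_group_add \<Rightarrow> 'v) \<Rightarrow> 'v set \<Rightarrow> bool" where
  "fin_dim_space s V \<longleftrightarrow> vector_space s \<and> (\<exists>B. finite B \<and> module.span s B = V)"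

definition linear_map_on ::
  "('k::field \<Rightarrow> 'v::ab_group_add \<Rightarrow> 'v) \<Rightarrow> ('k \<Rightarrow> 'w::ab_group_add \<Rightarrow> 'w)
    \<Rightarrow> 'v set \<Rightarrow> 'w set \<Rightarrow> ('v \<Rightarrow> 'w) \<Rightarrow> bool" where
  "linear_map_on s t V W h \<longleftrightarrow>
     h ` V \<subseteq> W \<and>
     (\<forall>x\<in>V. \<forall>y\<in>V. h (x + y) = h x + h y) \<and>
     (\<forall>a. \<forall>x\<in>V. h (s a x) = t a (h x))"

definition kronecker_rep :: "('k::field, 'v::ab_group_add, 'w::ab_group_add) kronecker \<Rightarrow> bool" where
  "kronecker_rep R \<longleftrightarrow>
     fin_dim_space (left_scale R) (left_space R) \<and>
     fin_dim_space (right_scale R) (right_space R) \<and>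
     linear_map_on (left_scale R) (right_scale R) (left_space R) (right_space R) (first_map R) \<and>
     linear_map_on (left_scale R) (right_scale R) (left_space R) (right_space R) (second_map R)"

definition subrepresentation ::
  "('k::field, 'v::ab_group_add, 'w::ab_group_add) kronecker
    \<Rightarrow> ('k, 'x::ab_group_add, 'y::ab_group_add) kronecker \<Rightarrow> bool" where
  "subrepresentation R' R \<longleftrightarrow>
     (\<exists>\<phi> \<psi>.
        linear_map_on (left_scale R') (left_scale R) (left_space R') (left_space R) \<phi> \<and>
        linear_map_on (right_scale R') (right_scale R) (right_space R') (right_space R) \<psi> \<and>
        inj_on \<phi> (left_space R') \<and> inj_on \<psi> (right_space R') \<and>
        (\<forall>x\<in>left_space R'. first_map R (\<phi> x) = \<psi> (first_map R' x)) \<and>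
        (\<forall>x\<in>left_space R'. second_map R (\<phi> x) = \<psi> (second_map R' x)))"

text \<open>External direct sum over a finite index set \<open>I\<close>; families vanish outside \<open>I\<close>.\<close>

definition direct_sum ::
  "'i set \<Rightarrow> ('i \<Rightarrow> ('k::field, 'v::ab_group_add, 'w::ab_group_add) kronecker)
    \<Rightarrow> ('k, 'i \<Rightarrow> 'v, 'i \<Rightarrow> 'w) kronecker" where
  "direct_sum I R =
    \<lparr> left_scale = (\<lambda>a x i. left_scale (R i) a (x i)),
      right_scale = (\<lambda>a y i. right_scale (R i) a (y i)),
      left_space = {x. (\<forall>i\<in>I. x i \<in> left_space (R i)) \<and> (\<forall>i. i \<notin> I \<longrightarrow> x i = 0)},
      right_space = {y. (\<forall>i\<in>I. y i \<in> right_space (R i)) \<and> (\<forall>i. i \<notin> I \<longrightarrow> y i = 0)},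
      first_map = (\<lambda>x i. if i \<in> I then first_map (R i) (x i) else 0),
      second_map = (\<lambda>x i. if i \<in> I then second_map (R i) (x i) else 0) \<rparr>"


section \<open>The indecomposable preinjective representations\<close>

text \<open>
  The coordinate space \<open>K\<^sup>d\<close> consists of the sequences supported on \<open>{0..<d}\<close>, and
  \<open>mat_map p q A\<close> is multiplication by the \<open>p \<times> q\<close> matrix with entries \<open>A r s\<close>,
  \<open>r < p\<close>, \<open>s < q\<close>.  For the \<open>(i - 1) \<times> i\<close> matrices below, \<open>[I 0]\<close> has its ones
  at the positions \<open>(r, r)\<close> and \<open>[0 I]\<close> at \<open>(r, r + 1)\<close>.
\<close>

definition coord_scale :: "'k::field \<Rightarrow> (nat \<Rightarrow> 'k) \<Rightarrow> nat \<Rightarrow> 'k" where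
  "coord_scale a x = (\<lambda>r. a * x r)"

definition coord_space :: "nat \<Rightarrow> (nat \<Rightarrow> 'k::field) set" where
  "coord_space d = {x. \<forall>r\<ge>d. x r = 0}"

definition mat_map :: "nat \<Rightarrow> nat \<Rightarrow> (nat \<Rightarrow> nat \<Rightarrow> 'k::field) \<Rightarrow> (nat \<Rightarrow> 'k) \<Rightarrow> nat \<Rightarrow> 'k" where
  "mat_map p q A x = (\<lambda>r. if r < p then \<Sum>s<q. A r s * x s else 0)"

definition J :: "nat \<Rightarrow> ('k::field, nat \<Rightarrow> 'k, nat \<Rightarrow> 'k) kronecker" where
  "J i =
    \<lparr> left_scale = coord_scale,
      right_scale = coord_scale,
      left_space = coord_space i,
      right_space = coord_space (i - 1),
      first_map = mat_map (i - 1) i (\<lambda>r s. if s = r then 1 else 0),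
      second_map = mat_map (i - 1) i (\<lambda>r s. if s = r + 1 then 1 else 0) \<rparr>"

lemma vector_space_coord_scale: "vector_space (coord_scale :: 'k::field \<Rightarrow> _)"
  by unfold_locales (auto simp: coord_scale_def fun_eq_iff algebra_simps)

lemma fin_dim_coord_space: "fin_dim_space coord_scale (coord_space d :: (nat \<Rightarrow> 'k::field) set)"
proof -
  interpret vector_space "coord_scale :: 'k \<Rightarrow> _" by (rule vector_space_coord_scale)
  define e where "e = (\<lambda>(s::nat) (r::nat). if r = s then (1::'k) else 0)"
  have sub: "subspace (coord_space d :: (nat \<Rightarrow> 'k) set)"
    by (auto simp: subspace_def coord_space_def coord_scale_def)
  have sum_apply: "(\<Sum>s<k. coord_scale (x s) (e s)) r = (if r < k then x r else 0)"
    for x r and k :: nat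
    by (induction k) (auto simp: e_def coord_scale_def less_Suc_eq)
  have "span (e ` {..<d}) = (coord_space d :: (nat \<Rightarrow> 'k) set)"
  proof
    show "span (e ` {..<d}) \<subseteq> coord_space d"
      by (rule span_minimal[OF _ sub]) (auto simp: e_def coord_space_def)
    show "coord_space d \<subseteq> span (e ` {..<d})"
    proof
      fix x :: "nat \<Rightarrow> 'k" assume "x \<in> coord_space d"
      then have "x = (\<Sum>s<d. coord_scale (x s) (e s))"
        by (auto simp: fun_eq_iff sum_apply coord_space_def)
      also have "\<dots> \<in> span (e ` {..<d})"
        by (intro span_sum span_scale span_base) auto
      finally show "x \<in> span (e ` {..<d})" .
    qed
  qed
  then show ?thesis
    unfolding fin_dim_space_def using vector_space_coord_scale by blast
qed

lemma linear_mat_map: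
  "linear_map_on coord_scale coord_scale (coord_space q) (coord_space p) (mat_map p q A)"
  by (auto simp: linear_map_on_def coord_scale_def coord_space_def mat_map_def fun_eq_iff
      algebra_simps sum.distrib sum_distrib_left)

lemma kronecker_rep_J: "kronecker_rep (J i)"
  by (simp add: kronecker_rep_def J_def fin_dim_coord_space linear_mat_map)

lemma fin_dim_family_space:
  fixes s :: "'i \<Rightarrow> 'k::field \<Rightarrow> 'v::ab_group_add \<Rightarrow> 'v"
  assumes I: "finite I" and V: "\<And>i. fin_dim_space (s i) (V i)"
  shows "fin_dim_space (\<lambda>a x i. s i a (x i))
           {x. (\<forall>i\<in>I. x i \<in> V i) \<and> (\<forall>i. i \<notin> I \<longrightarrow> x i = 0)}"
    (is "fin_dim_space ?s ?V")
proof -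
  have vs: "vector_space (s i)" for i using V by (simp add: fin_dim_space_def)
  have mo: "module (s i)" for i using vs by (simp add: module_iff_vector_space)
  note laws = vector_space.vector_space_assms[OF vs]
  interpret S: vector_space ?s
    by unfold_locales (simp_all add: fun_eq_iff laws)
  obtain B where B: "\<And>i. finite (B i)" "\<And>i. module.span (s i) (B i) = V i"
    using V unfolding fin_dim_space_def by metis
  define e where "e i v = (\<lambda>j. if j = i then v else (0::'v))" for i :: 'i and v
  let ?B = "\<Union>i\<in>I. e i ` B i"
  have subV: "module.subspace (s i) (V i)" for i
    using B(2) module.subspace_span[OF mo] by metis
  have sub: "S.subspace ?V"
    by (auto simp: S.subspace_def module.subspace_0[OF mo subV] module.subspace_add[OF mo subV]
        module.subspace_scale[OF mo subV] module.scale_zero_right[OF mo])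
  have single: "e i v \<in> S.span ?B" if "i \<in> I" "v \<in> V i" for i v
  proof -
    have "v \<in> module.span (s i) (B i)" using that B by simp
    then show ?thesis
    proof (induction rule: module.span_induct_alt[OF mo, consumes 1])
      case 1
      have "e i 0 = 0" by (auto simp: e_def fun_eq_iff)
      then show ?case by (simp only: S.span_zero)
    next
      case (2 c x y)
      have "e i (s i c x + y) = ?s c (e i x) + e i y"
        by (auto simp: e_def fun_eq_iff module.scale_zero_right[OF mo])
      moreover have "e i x \<in> S.span ?B" using 2 that by (intro S.span_base) auto
      ultimately show ?case using 2 by (simp only: S.span_add S.span_scale)
    qed
  qed
  have "S.span ?B = ?V"
  proof
    show "S.span ?B \<subseteq> ?V"
      by (rule S.span_minimal[OF _ sub])
        (auto simp: e_def B(2)[symmetric] module.span_base[OF mo] module.span_zero[OF mo])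
    show "?V \<subseteq> S.span ?B"
    proof
      fix x assume x: "x \<in> ?V"
      have "(\<Sum>i\<in>F. e i (x i)) j = (if j \<in> F then x j else 0)" if "finite F" for F j
        using that by induction (auto simp: e_def)
      then have "x = (\<Sum>i\<in>I. e i (x i))" using x I by (auto simp: fun_eq_iff)
      also have "\<dots> \<in> S.span ?B" using x by (intro S.span_sum single) auto
      finally show "x \<in> S.span ?B" .
    qed
  qed
  moreover have "finite ?B" using I B by auto
  ultimately show ?thesis
    unfolding fin_dim_space_def using S.vector_space_axioms by blast
qed

lemma kronecker_rep_direct_sum:
  assumes "finite I" and R: "\<And>i. kronecker_rep (R i)"
  shows "kronecker_rep (direct_sum I R)"
proof -
  have "module (right_scale (R i))" for i
    using R by (simp add: kronecker_rep_def fin_dim_space_def module_iff_vector_space)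
  note zero = module.scale_zero_right[OF this]
  have lin: "linear_map_on (left_scale (R i)) (right_scale (R i)) (left_space (R i))
        (right_space (R i)) (first_map (R i))"
      "linear_map_on (left_scale (R i)) (right_scale (R i)) (left_space (R i))
        (right_space (R i)) (second_map (R i))" for i
    using R by (simp_all add: kronecker_rep_def)
  have "fin_dim_space (left_scale (R i)) (left_space (R i))"
    "fin_dim_space (right_scale (R i)) (right_space (R i))" for i
    using R by (simp_all add: kronecker_rep_def)
  from this[THEN fin_dim_family_space[OF assms(1)]]
  show ?thesis
    using lin by (auto simp: kronecker_rep_def direct_sum_def linear_map_on_def fun_eq_iff zero
        image_subset_iff)
qed


section \<open>The integers attached to two sequences\<close>

text \<open>
  A sequence \<open>c\<^sub>1, \<dots>, c\<^sub>m\<close> is a function whose values outside \<open>{1..m}\<close> are irrelevant;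
  \<open>extend0\<close> supplies the convention \<open>c\<^sub>m\<^sub>+\<^sub>1 = 0\<close>.  The maximum of the empty set is \<open>0\<close>
  because \<open>0\<close> is inserted.
\<close>

definition extend0 :: "nat \<Rightarrow> (nat \<Rightarrow> nat) \<Rightarrow> nat \<Rightarrow> nat" where
  "extend0 m c j = (if j \<in> {1..m} then c j else 0)"

definition max0 :: "nat set \<Rightarrow> nat" where
  "max0 A = Max (insert 0 A)"

definition next_u :: "nat \<Rightarrow> (nat \<Rightarrow> nat) \<Rightarrow> nat \<Rightarrow> (nat \<Rightarrow> nat) \<Rightarrow> nat \<Rightarrow> nat" where
  "next_u m c n f v = max0 {j \<in> {1..m}. c j > extend0 n f (v + 1)}"

definition next_v :: "nat \<Rightarrow> (nat \<Rightarrow> nat) \<Rightarrow> nat \<Rightarrow> (nat \<Rightarrow> nat) \<Rightarrow> nat \<Rightarrow> nat" where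
  "next_v m c n f u = max0 {i \<in> {1..n}. extend0 m c (u + 1) \<le> f i}"

primrec v_index :: "nat \<Rightarrow> (nat \<Rightarrow> nat) \<Rightarrow> nat \<Rightarrow> (nat \<Rightarrow> nat) \<Rightarrow> nat \<Rightarrow> nat" where
  "v_index m c n f 0 = 0"
| "v_index m c n f (Suc l) = next_v m c n f (next_u m c n f (v_index m c n f l))"

text \<open>Only \<open>l \<ge> 1\<close> is meaningful for \<open>u_index\<close>.\<close>

definition u_index :: "nat \<Rightarrow> (nat \<Rightarrow> nat) \<Rightarrow> nat \<Rightarrow> (nat \<Rightarrow> nat) \<Rightarrow> nat \<Rightarrow> nat" where
  "u_index m c n f l = next_u m c n f (v_index m c n f (l - 1))"

lemma v_index_Suc: "v_index m c n f (Suc l) = next_v m c n f (u_index m c n f (Suc l))"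
  by (simp add: u_index_def)

definition w_index :: "nat \<Rightarrow> (nat \<Rightarrow> nat) \<Rightarrow> nat \<Rightarrow> (nat \<Rightarrow> nat) \<Rightarrow> nat" where
  "w_index m c n f = (LEAST l. 1 \<le> l \<and> u_index m c n f l = m)"

lemma w_index_exists:
  assumes "\<forall>i\<in>{1..m}. 0 < c i"
  shows "\<exists>l. 1 \<le> l \<and> u_index m c n f l = m"
proof -
  have Max_ge0: "x \<le> max0 A" if "finite A" "x \<in> A" for x and A :: "nat set"
    using that by (simp add: max0_def)
  have Max_le0: "max0 A \<le> k" if "A \<subseteq> {1..k}" for k and A :: "nat set"
    using that finite_subset[OF that] by (auto simp: max0_def)
  have step: "v + 1 \<le> next_v m c n f (next_u m c n f v)" if "v < n" for v
  proof -
    let ?u = "next_u m c n f v"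
    have "extend0 m c (?u + 1) \<le> f (v + 1)"
    proof (rule ccontr)
      assume *: "\<not> extend0 m c (?u + 1) \<le> f (v + 1)"
      then have "?u + 1 \<in> {j \<in> {1..m}. c j > extend0 n f (v + 1)}"
        using that by (auto simp: extend0_def split: if_splits)
      from Max_ge0[OF _ this] show False by (simp add: next_u_def)
    qed
    with that show ?thesis
      unfolding next_v_def by (intro Max_ge0) auto
  qed
  have "min l n \<le> v_index m c n f l" for l
  proof (induction l)
    case (Suc l)
    then show ?case
    proof (cases "v_index m c n f l < n")
      case True
      with step[OF True] Suc show ?thesis by simp
    next
      case False
      show ?thesis
      proof (cases "n = 0")
        case False
        have "extend0 m c (next_u m c n f (v_index m c n f l) + 1) \<le> f n"
        proof (rule ccontr)
          let ?v = "v_index m c n f l"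
          assume *: "\<not> extend0 m c (next_u m c n f ?v + 1) \<le> f n"
          have "extend0 n f (?v + 1) = 0"
            using \<open>\<not> ?v < n\<close> by (simp add: extend0_def)
          with * have "next_u m c n f ?v + 1 \<in> {j \<in> {1..m}. c j > extend0 n f (?v + 1)}"
            by (auto simp: extend0_def split: if_splits)
          from Max_ge0[OF _ this] show False by (simp add: next_u_def)
        qed
        with False have "n \<le> v_index m c n f (Suc l)"
          by (auto simp: next_v_def intro!: Max_ge0)
        then show ?thesis by simp
      qed simp
    qed
  qed simp
  from this[of n] have "n \<le> v_index m c n f n" by simp
  then have "u_index m c n f (Suc n) = max0 {1..m}"
    using assms by (auto simp: u_index_def next_u_def extend0_def intro!: arg_cong[of _ _ max0])
  also have "\<dots> = m"
    using Max_le0[of "{1..m}" m] Max_ge0[of "{1..m}" m] by (cases "m = 0") auto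
  finally show ?thesis by (intro exI[of _ "Suc n"]) simp
qed

end

theory Submission
  imports Defs
begin

text \<open>
  Both sides of the equivalence say the same as the following family of dimension bounds: for
  every \<open>k\<close>, the summands \<open>J (f j)\<close> of \<open>N\<close> with \<open>k \<le> j\<close> have, on the left and on the right, at
  most the total dimension of the summands \<open>J (c l)\<close> of \<open>M\<close> with \<open>c l \<le> f k\<close>.

  The bounds are necessary because there is no nonzero homomorphism from \<open>J i\<close> to \<open>J c\<close> when
  \<open>i < c\<close>: an embedding of \<open>N\<close> must send the summands from \<open>k\<close> on into the summands of \<open>M\<close> with
  \<open>c l \<le> f k\<close> (\<open>embedding_imp_dimension_bounds\<close>).

  They are sufficient by an explicit embedding.  For \<open>t + c \<le> f\<close>, reading off the window of
  coordinates \<open>t, \<dots>, t + c - 1\<close> on the left, and \<open>t, \<dots>, t + c - 2\<close> on the right, is a homomorphism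
  from \<open>J f\<close> to \<open>J c\<close>.  The windows are chosen by looking at right spaces.  Lay the slots of
  lengths \<open>f k - 1\<close> end to end, the shortest first, and over them the tiles of lengths \<open>c l - 1\<close>,
  again the shortest first.  By the right bounds the tiles cover all slots and no tile is longer
  than a slot that it meets; as the slots grow, a tile then meets at most two of them.
  Let \<open>J (c l)\<close> read a window of each slot met by its tile, pushed inside that slot if the tile
  sticks out.  A vector in the kernel then satisfies equations with one or two terms each, and these are triangular
  (\<open>tiling_equations_trivial\<close>).  On left spaces injectivity follows, because in \<open>J f\<close> only
  \<open>f = 1\<close> leaves a vector that both structure maps kill; the summands \<open>J 1\<close> of \<open>N\<close> are sent to
  summands \<open>J 1\<close> of \<open>M\<close>, of which there are enough by the left bounds
  (\<open>dimension_bounds_imp_embedding\<close>).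

  Finally the bounds need to be checked only at the first index \<open>k = v i + 1\<close> of each block: inside
  a block the set of available summands of \<open>M\<close> stays the same while fewer summands of \<open>N\<close> remain
  (\<open>index_conditions_iff_dimension_bounds\<close>).
\<close>

section \<open>Direct sums of preinjectives in coordinates\<close>

definition family_scale :: "'k::field \<Rightarrow> (nat \<Rightarrow> nat \<Rightarrow> 'k) \<Rightarrow> nat \<Rightarrow> nat \<Rightarrow> 'k" where
  "family_scale a x = (\<lambda>i. coord_scale a (x i))"

definition family_space :: "nat set \<Rightarrow> (nat \<Rightarrow> nat) \<Rightarrow> (nat \<Rightarrow> nat \<Rightarrow> 'k::field) set" where
  "family_space I p = {x. (\<forall>i\<in>I. x i \<in> coord_space (p i)) \<and> (\<forall>i. i \<notin> I \<longrightarrow> x i = 0)}"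

lemma family_space_iff: "x \<in> family_space I p \<longleftrightarrow> (\<forall>i r. \<not> (i \<in> I \<and> r < p i) \<longrightarrow> x i r = 0)"
  by (auto simp: family_space_def coord_space_def fun_eq_iff not_less)

lemma family_scale_apply [simp]: "family_scale a x i r = a * x i r"
  by (simp add: family_scale_def coord_scale_def)

definition first_family :: "nat set \<Rightarrow> (nat \<Rightarrow> nat) \<Rightarrow> (nat \<Rightarrow> nat \<Rightarrow> 'k::field) \<Rightarrow> nat \<Rightarrow> nat \<Rightarrow> 'k" where
  "first_family I c x = (\<lambda>i r. if i \<in> I \<and> r < c i - 1 then x i r else 0)"

definition second_family :: "nat set \<Rightarrow> (nat \<Rightarrow> nat) \<Rightarrow> (nat \<Rightarrow> nat \<Rightarrow> 'k::field) \<Rightarrow> nat \<Rightarrow> nat \<Rightarrow> 'k" where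
  "second_family I c x = (\<lambda>i r. if i \<in> I \<and> r < c i - 1 then x i (r + 1) else 0)"

lemma direct_sum_J:
  "direct_sum I (\<lambda>i. J (c i)) =
    \<lparr> left_scale = family_scale, right_scale = family_scale,
      left_space = family_space I c, right_space = family_space I (\<lambda>i. c i - 1),
      first_map = first_family I c, second_map = second_family I c \<rparr>"
proof -
  have 1: "(\<Sum>s<q. (if s = r then 1 else 0) * y s) = y r" if "r < q"
    for q r :: nat and y :: "nat \<Rightarrow> 'k::field"
  proof -
    have "(\<Sum>s<q. (if s = r then 1 else 0) * y s) = (\<Sum>s<q. if s = r then y s else 0)"
      by (intro sum.cong) auto
    with that show ?thesis by simp
  qed
  show ?thesis
    by (auto simp: direct_sum_def J_def family_scale_def family_space_def first_family_def
        second_family_def mat_map_def fun_eq_iff 1)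
qed

lemma subrepresentation_direct_sum_J:
  "subrepresentation (direct_sum I (\<lambda>i. J (f i))) (direct_sum I' (\<lambda>i. J (c i)) ::
      ('k::field, nat \<Rightarrow> nat \<Rightarrow> 'k, nat \<Rightarrow> nat \<Rightarrow> 'k) kronecker) \<longleftrightarrow>
    (\<exists>\<phi> \<psi>. linear_map_on family_scale family_scale
          (family_space I f :: (nat \<Rightarrow> nat \<Rightarrow> 'k) set) (family_space I' c) \<phi> \<and>
        linear_map_on family_scale family_scale
          (family_space I (\<lambda>i. f i - 1) :: (nat \<Rightarrow> nat \<Rightarrow> 'k) set)
          (family_space I' (\<lambda>i. c i - 1)) \<psi> \<and>
        inj_on \<phi> (family_space I f) \<and> inj_on \<psi> (family_space I (\<lambda>i. f i - 1)) \<and>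
        (\<forall>x\<in>family_space I f. first_family I' c (\<phi> x) = \<psi> (first_family I f x)) \<and>
        (\<forall>x\<in>family_space I f. second_family I' c (\<phi> x) = \<psi> (second_family I f x)))"
  by (simp add: subrepresentation_def direct_sum_J)


section \<open>Homomorphisms between preinjectives and dimension bounds\<close>

definition unit_family :: "nat \<Rightarrow> nat \<Rightarrow> nat \<Rightarrow> nat \<Rightarrow> 'k::field" where
  "unit_family j s = (\<lambda>i r. if i = j \<and> r = s then 1 else 0)"

lemma vector_space_family_scale: "vector_space (family_scale :: 'k::field \<Rightarrow> _)"
  by unfold_locales (auto simp: fun_eq_iff algebra_simps)

lemma sum_family_apply:
  fixes g :: "'b \<Rightarrow> nat \<Rightarrow> nat \<Rightarrow> 'k::field"
  shows "(\<Sum>a\<in>F. g a) i r = (\<Sum>a\<in>F. g a i r)"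
  by (induction F rule: infinite_finite_induct) auto

lemma sum_unit_family:
  fixes a :: "nat \<Rightarrow> nat \<Rightarrow> 'k::field"
  assumes "finite F"
  shows "(\<Sum>(j, s)\<in>F. family_scale (a j s) (unit_family j s)) i r
    = (if (i, r) \<in> F then a i r else 0)"
proof -
  have "(\<Sum>(j, s)\<in>F. family_scale (a j s) (unit_family j s)) i r
      = (\<Sum>q\<in>F. if q = (i, r) then a i r else 0)"
    unfolding sum_family_apply
    by (intro sum.cong) (auto simp: unit_family_def split: if_splits)
  with assms show ?thesis by simp
qed

lemma linear_map_on_sum:
  assumes h: "linear_map_on family_scale family_scale (family_space I p) W h"
    and x: "\<And>q. q \<in> F \<Longrightarrow> x q \<in> (family_space I p :: (nat \<Rightarrow> nat \<Rightarrow> 'k::field) set)"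
  shows "h (\<Sum>q\<in>F. family_scale (a q) (x q)) = (\<Sum>q\<in>F. family_scale (a q) (h (x q)))
    \<and> (\<Sum>q\<in>F. family_scale (a q) (x q)) \<in> family_space I p"
proof -
  have sc: "family_scale b y \<in> family_space I p" if "y \<in> family_space I p"
    for b and y :: "nat \<Rightarrow> nat \<Rightarrow> 'k" using that by (simp add: family_space_iff)
  have ad: "y + y' \<in> family_space I p" if "y \<in> family_space I p" "y' \<in> family_space I p"
    for y y' :: "nat \<Rightarrow> nat \<Rightarrow> 'k" using that by (simp add: family_space_iff)
  have z: "(0 :: nat \<Rightarrow> nat \<Rightarrow> 'k) \<in> family_space I p" by (simp add: family_space_iff)
  have "h (0 + 0) = h 0 + h 0" using h z unfolding linear_map_on_def by blast
  then have h0: "h 0 = 0" by simp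
  from x show ?thesis
  proof (induction F rule: infinite_finite_induct)
    case (insert q F)
    let ?S = "\<Sum>q\<in>F. family_scale (a q) (x q)"
    have mem: "family_scale (a q) (x q) \<in> family_space I p" "?S \<in> family_space I p"
      using insert sc by blast+
    then have "h (family_scale (a q) (x q) + ?S) = h (family_scale (a q) (x q)) + h ?S"
      using h unfolding linear_map_on_def by blast
    also have "h (family_scale (a q) (x q)) = family_scale (a q) (h (x q))"
      using h insert.prems unfolding linear_map_on_def by blast
    also have "h ?S = (\<Sum>q\<in>F. family_scale (a q) (h (x q)))"
      using insert by blast
    finally show ?case
      using ad[OF mem] insert.hyps by (simp only: sum.insert simp_thms)
  qed (simp_all add: h0 z)
qed

text \<open>
  Injectivity makes the images of the unit vectors at the places in \<open>K\<close> independent, and they lie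
  in the span of the unit vectors at the places in \<open>A\<close>.
\<close>

lemma dimension_bound:
  fixes h :: "(nat \<Rightarrow> nat \<Rightarrow> 'k::field) \<Rightarrow> nat \<Rightarrow> nat \<Rightarrow> 'k"
  assumes h: "linear_map_on family_scale family_scale (family_space I p) (family_space I' q) h"
    and inj: "inj_on h (family_space I p)"
    and K: "K \<subseteq> I" "finite K" and A: "finite A"
    and vanish: "\<And>j s l. j \<in> K \<Longrightarrow> s < p j \<Longrightarrow> l \<in> I' - A \<Longrightarrow> h (unit_family j s) l = 0"
  shows "(\<Sum>j\<in>K. p j) \<le> (\<Sum>l\<in>A. q l)"
proof -
  interpret vector_space "family_scale :: 'k \<Rightarrow> _" by (rule vector_space_family_scale)
  define P where "P = Sigma K (\<lambda>j. {..<p j})"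
  define Q where "Q = Sigma A (\<lambda>l. {..<q l})"
  define e where "e = (\<lambda>(j, s). unit_family j s :: nat \<Rightarrow> nat \<Rightarrow> 'k)"
  have fin: "finite P" "finite Q" using K A by (auto simp: P_def Q_def)
  have eP: "e x \<in> family_space I p" if "x \<in> P" for x
    using that K by (auto simp: e_def P_def family_space_iff unit_family_def)
  have "inj e" by (auto simp: inj_on_def e_def unit_family_def fun_eq_iff split: if_splits)
  then have inj_he: "inj_on (h \<circ> e) P"
    using inj eP by (intro comp_inj_on) (auto intro: inj_on_subset)
  let ?B = "(h \<circ> e) ` P"
  have "independent ?B"
  proof
    assume "dependent ?B"
    then obtain u y where y: "y \<in> ?B" "u y \<noteq> 0" and s: "(\<Sum>v\<in>?B. family_scale (u v) v) = 0"
      using dependent_finite[of ?B] fin by auto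
    let ?a = "\<lambda>x. u (h (e x))"
    have "0 = (\<Sum>x\<in>P. family_scale (?a x) (h (e x)))"
      using s unfolding sum.reindex[OF inj_he] by (simp only: o_def)
    also have "\<dots> = h (\<Sum>x\<in>P. family_scale (?a x) (e x))"
      using linear_map_on_sum[OF h, of P e ?a] eP by simp
    finally have 1: "h (\<Sum>x\<in>P. family_scale (?a x) (e x)) = 0" by simp
    have 2: "h 0 = 0" "(0 :: nat \<Rightarrow> nat \<Rightarrow> 'k) \<in> family_space I p"
      using linear_map_on_sum[OF h, of "{}" e ?a] by (auto simp: family_space_iff)
    have "(\<Sum>x\<in>P. family_scale (?a x) (e x)) = 0"
      using inj 1 2 linear_map_on_sum[OF h, of P e ?a] eP by (metis inj_onD)
    moreover have "(\<Sum>x\<in>P. family_scale (?a x) (e x))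
        = (\<Sum>(j, s)\<in>P. family_scale (?a (j, s)) (unit_family j s))"
      by (intro sum.cong) (auto simp: e_def)
    ultimately have "?a (j, s) = 0" if "(j, s) \<in> P" for j s
      using sum_unit_family[OF fin(1), of "\<lambda>j s. ?a (j, s)" j s] that by simp
    with y show False by auto
  qed
  moreover have "?B \<subseteq> span (e ` Q)"
  proof
    fix y assume "y \<in> ?B"
    then obtain x where x: "x \<in> P" "y = h (e x)" by auto
    have 0: "y l r = 0" if "(l, r) \<notin> Q" for l r
    proof (cases "l \<in> I'")
      case True
      show ?thesis
      proof (cases "l \<in> A")
        case True
        then have "\<not> r < q l" using that by (auto simp: Q_def)
        then show ?thesis using h x eP[OF x(1)]
          by (auto simp: linear_map_on_def family_space_iff image_subset_iff)
      next
        case False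
        then show ?thesis using vanish x \<open>l \<in> I'\<close> by (auto simp: P_def e_def)
      qed
    next
      case False
      then show ?thesis using h x eP[OF x(1)]
        by (auto simp: linear_map_on_def family_space_iff image_subset_iff)
    qed
    have "y = (\<Sum>(l, r)\<in>Q. family_scale (y l r) (unit_family l r))"
      using 0 by (auto simp: fun_eq_iff sum_unit_family[OF fin(2)])
    also have "\<dots> \<in> span (e ` Q)"
    proof (intro span_sum, clarify)
      fix l r assume "(l, r) \<in> Q"
      then have "unit_family l r \<in> e ` Q" by (force simp: e_def)
      then show "family_scale (y l r) (unit_family l r) \<in> span (e ` Q)"
        by (intro span_scale span_base)
    qed
    finally show "y \<in> span (e ` Q)" .
  qed
  ultimately have "card ?B \<le> card (e ` Q)"
    using independent_span_bound fin by blast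
  also have "\<dots> \<le> card Q" using fin by (intro card_image_le)
  finally show ?thesis
    using K A unfolding card_image[OF inj_he] by (simp add: P_def Q_def)
qed

text \<open>
  The images \<open>y 0, \<dots>, y (i - 1)\<close> in \<open>J c\<close> of the standard basis of the left space of \<open>J i\<close> satisfy
  the three relations below.  By the first two, \<open>y s r\<close> is constant along diagonals and zero for
  \<open>s < r\<close>; since \<open>i < c\<close>, the last relation kills every diagonal that is left.
\<close>

lemma hom_smaller_preinjective_zero:
  fixes y :: "nat \<Rightarrow> nat \<Rightarrow> 'k::field"
  assumes "i < c"
    and first: "\<And>r. r < c - 1 \<Longrightarrow> y 0 (r + 1) = 0"
    and step: "\<And>s r. s + 1 < i \<Longrightarrow> r < c - 1 \<Longrightarrow> y s r = y (s + 1) (r + 1)"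
    and last: "\<And>r. r < c - 1 \<Longrightarrow> y (i - 1) r = 0"
    and "s < i" "r < c"
  shows "y s r = 0"
proof -
  have diag: "y s r = (if r \<le> s then y (s - r) 0 else 0)" if "s < i" "r < c" for s r
    using that
  proof (induction s arbitrary: r)
    case 0
    then show ?case using first[of "r - 1"] by (cases r) auto
  next
    case (Suc s)
    show ?case
    proof (cases r)
      case (Suc r')
      then have "y (Suc s) r = y s r'" using step[of s r'] Suc.prems by simp
      then show ?thesis using Suc.IH[of r'] Suc.prems \<open>r = Suc r'\<close> by simp
    qed simp
  qed
  have "y t 0 = 0" if "t < i" for t
  proof -
    obtain r where "i = Suc (r + t)" using \<open>t < i\<close> by (metis add.commute less_imp_Suc_add)
    then show ?thesis using diag[of "i - 1" r] last[of r] \<open>i < c\<close> by simp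
  qed
  moreover have "s - r < i" using \<open>s < i\<close> by simp
  ultimately show ?thesis using diag[OF \<open>s < i\<close> \<open>r < c\<close>] by simp
qed

lemma embedding_imp_dimension_bounds:
  fixes m n k :: nat and c f :: "nat \<Rightarrow> nat"
  assumes sub: "subrepresentation (direct_sum {1..n} (\<lambda>j. J (f j)))
      (direct_sum {1..m} (\<lambda>i. J (c i)) ::
        ('k::field, nat \<Rightarrow> nat \<Rightarrow> 'k, nat \<Rightarrow> nat \<Rightarrow> 'k) kronecker)"
    and dec: "\<And>i j. 1 \<le> i \<Longrightarrow> i \<le> j \<Longrightarrow> j \<le> n \<Longrightarrow> f j \<le> f i"
    and k: "k \<in> {1..n}"
  shows "(\<Sum>j = k..n. f j) \<le> (\<Sum>l | l \<in> {1..m} \<and> c l \<le> f k. c l)"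
    and "(\<Sum>j = k..n. f j - 1) \<le> (\<Sum>l | l \<in> {1..m} \<and> c l \<le> f k. c l - 1)"
proof -
  from sub obtain \<phi> \<psi> where
    lin: "linear_map_on family_scale family_scale
          (family_space {1..n} f :: (nat \<Rightarrow> nat \<Rightarrow> 'k) set) (family_space {1..m} c) \<phi>"
        "linear_map_on family_scale family_scale
          (family_space {1..n} (\<lambda>i. f i - 1) :: (nat \<Rightarrow> nat \<Rightarrow> 'k) set)
          (family_space {1..m} (\<lambda>i. c i - 1)) \<psi>"
    and inj: "inj_on \<phi> (family_space {1..n} f)" "inj_on \<psi> (family_space {1..n} (\<lambda>i. f i - 1))"
    and hom: "\<And>x. x \<in> family_space {1..n} f \<Longrightarrow>
          first_family {1..m} c (\<phi> x) = \<psi> (first_family {1..n} f x)"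
        "\<And>x. x \<in> family_space {1..n} f \<Longrightarrow>
          second_family {1..m} c (\<phi> x) = \<psi> (second_family {1..n} f x)"
    unfolding subrepresentation_direct_sum_J by blast
  let ?A = "{l. l \<in> {1..m} \<and> c l \<le> f k}"
  have \<psi>0: "\<psi> 0 = 0"
    using linear_map_on_sum[OF lin(2), of "{}" "\<lambda>_. 0" "\<lambda>_. 0"] by simp
  have unit: "unit_family j s \<in> (family_space {1..n} f :: (nat \<Rightarrow> nat \<Rightarrow> 'k) set)"
    if "j \<in> {1..n}" "s < f j" for j s
    using that by (auto simp: family_space_iff unit_family_def)
  have first: "first_family {1..m} c (\<phi> (unit_family j s))
      = (if s + 1 < f j then \<psi> (unit_family j s) else 0)" if "j \<in> {1..n}" "s < f j" for j s
  proof -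
    have "first_family {1..n} f (unit_family j s)
        = (if s + 1 < f j then unit_family j s else (0 :: nat \<Rightarrow> nat \<Rightarrow> 'k))"
      using that by (auto simp: first_family_def unit_family_def fun_eq_iff)
    then show ?thesis using hom(1)[OF unit[OF that]] \<psi>0 by simp
  qed
  have second: "second_family {1..m} c (\<phi> (unit_family j s))
      = (if 0 < s then \<psi> (unit_family j (s - 1)) else 0)" if "j \<in> {1..n}" "s < f j" for j s
  proof -
    have "second_family {1..n} f (unit_family j s)
        = (if 0 < s then unit_family j (s - 1) else (0 :: nat \<Rightarrow> nat \<Rightarrow> 'k))"
      using that by (auto simp: second_family_def unit_family_def fun_eq_iff)
    then show ?thesis using hom(2)[OF unit[OF that]] \<psi>0 by simp
  qed
  have vanish: "\<phi> (unit_family j s) l = 0"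
    if j: "j \<in> {k..n}" and s: "s < f j" and l: "l \<in> {1..m} - ?A" for j s l
  proof
    fix r
    have jn: "j \<in> {1..n}" and "f j \<le> f k" using j k dec[of k j] by auto
    with l have small: "f j < c l" by auto
    note F = first[OF jn, THEN fun_cong, THEN fun_cong, of _ l]
    note G = second[OF jn, THEN fun_cong, THEN fun_cong, of _ l]
    have lm: "l \<in> {1..m}" using l by simp
    show "\<phi> (unit_family j s) l r = 0 r"
    proof (cases "r < c l")
      case True
      have "\<phi> (unit_family j s) l r = 0"
      proof (rule hom_smaller_preinjective_zero[OF small, of "\<lambda>s. \<phi> (unit_family j s) l"])
        show "\<phi> (unit_family j 0) l (r + 1) = 0" if "r < c l - 1" for r
          using G[of 0 r] that lm s by (simp add: second_family_def)
        show "\<phi> (unit_family j s) l r = \<phi> (unit_family j (s + 1)) l (r + 1)"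
          if "s + 1 < f j" "r < c l - 1" for s r
          using F[of s r] G[of "s + 1" r] that lm
          by (simp add: first_family_def second_family_def)
        show "\<phi> (unit_family j (f j - 1)) l r = 0" if "r < c l - 1" for r
          using F[of "f j - 1" r] that lm s by (simp add: first_family_def)
      qed (use s True in auto)
      then show ?thesis by simp
    next
      case False
      then show ?thesis using lin(1) unit[OF jn s]
        by (auto simp: linear_map_on_def family_space_iff image_subset_iff)
    qed
  qed
  show "(\<Sum>j = k..n. f j) \<le> (\<Sum>l | l \<in> {1..m} \<and> c l \<le> f k. c l)"
    by (rule dimension_bound[OF lin(1) inj(1)]) (use k vanish in auto)
  show "(\<Sum>j = k..n. f j - 1) \<le> (\<Sum>l | l \<in> {1..m} \<and> c l \<le> f k. c l - 1)"
  proof (rule dimension_bound[OF lin(2) inj(2)])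
    fix j s l assume *: "j \<in> {k..n}" "s < f j - 1" "l \<in> {1..m} - ?A"
    then have "\<psi> (unit_family j s) = first_family {1..m} c (\<phi> (unit_family j s))"
      using first[of j s] k by simp
    then show "\<psi> (unit_family j s) l = 0"
      using vanish[of j s l] * by (simp add: first_family_def fun_eq_iff)
  qed (use k in auto)
qed


section \<open>Tilings and triangular systems\<close>

lemma position_in_suffix_sums:
  fixes g :: "nat \<Rightarrow> nat"
  assumes "P < (\<Sum>j = 1..m. g j)"
  shows "\<exists>l\<in>{1..m}. (\<Sum>j = l + 1..m. g j) \<le> P \<and> P < (\<Sum>j = l + 1..m. g j) + g l"
  using assms
proof (induction m arbitrary: P)
  case (Suc m)
  show ?case
  proof (cases "P < g (Suc m)")
    case True
    then show ?thesis by (intro bexI[of _ "Suc m"]) auto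
  next
    case False
    then have "P - g (Suc m) < (\<Sum>j = 1..m. g j)" using Suc.prems by simp
    from Suc.IH[OF this] obtain l where l: "l \<in> {1..m}"
        "(\<Sum>j = l + 1..m. g j) \<le> P - g (Suc m)"
        "P - g (Suc m) < (\<Sum>j = l + 1..m. g j) + g l" by blast
    have "(\<Sum>j = l + 1..Suc m. g j) = (\<Sum>j = l + 1..m. g j) + g (Suc m)"
      using l(1) by simp
    with False l show ?thesis
      by (intro bexI[of _ l]) auto
  qed
qed simp

text \<open>
  Slots and tiles are placed in order of decreasing index, which puts the shorter slots first; the
  positions are therefore suffix sums.
\<close>

locale tiling =
  fixes m n :: nat and d e :: "nat \<Rightarrow> nat"
  assumes e_decreasing: "\<And>i j. 1 \<le> i \<Longrightarrow> i \<le> j \<Longrightarrow> j \<le> n \<Longrightarrow> e j \<le> e i"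
    and tile_fits: "\<And>l k. l \<in> {1..m} \<Longrightarrow> k \<in> {1..n} \<Longrightarrow>
      (\<Sum>j = l + 1..m. d j) < (\<Sum>j = k..n. e j) \<Longrightarrow> d l \<le> e k"
    and tiles_cover: "(\<Sum>j = 1..n. e j) \<le> (\<Sum>j = 1..m. d j)"
begin

definition tile_start :: "nat \<Rightarrow> nat" where
  "tile_start l = (\<Sum>j = l + 1..m. d j)"

definition slot_start :: "nat \<Rightarrow> nat" where
  "slot_start k = (\<Sum>j = k + 1..n. e j)"

definition meets :: "nat \<Rightarrow> nat \<Rightarrow> bool" where
  "meets l k \<longleftrightarrow>
    {tile_start l..<tile_start l + d l} \<inter> {slot_start k..<slot_start k + e k} \<noteq> {}"

text \<open>
  The position within slot \<open>k\<close> at which tile \<open>l\<close> starts to read.  A tile inside the slot reads what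
  lies under it; truncated subtraction moves a tile that begins too early to the start of the
  slot, and the minimum moves one that ends too late back to the end.
\<close>

definition offset :: "nat \<Rightarrow> nat \<Rightarrow> nat" where
  "offset l k = min (tile_start l - slot_start k) (e k - d l)"

lemma meets_iff:
  "meets l k \<longleftrightarrow> 0 < d l \<and> 0 < e k \<and>
    tile_start l < slot_start k + e k \<and> slot_start k < tile_start l + d l"
proof
  assume "0 < d l \<and> 0 < e k \<and>
    tile_start l < slot_start k + e k \<and> slot_start k < tile_start l + d l"
  then have "max (tile_start l) (slot_start k) \<in>
      {tile_start l..<tile_start l + d l} \<inter> {slot_start k..<slot_start k + e k}"
    by auto
  then show "meets l k" unfolding meets_def by blast
qed (auto simp: meets_def)

lemma slot_end: "k \<in> {1..n} \<Longrightarrow> slot_start k + e k = (\<Sum>j = k..n. e j)"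
  using sum.atLeast_Suc_atMost[of k n e] by (simp add: slot_start_def)

lemma slot_start_pred: "k \<in> {1..n} \<Longrightarrow> slot_start (k - 1) = slot_start k + e k"
  by (subst slot_end) (auto simp: slot_start_def)

lemma tile_order: "l < l' \<Longrightarrow> l' \<in> {1..m} \<Longrightarrow> tile_start l' + d l' \<le> tile_start l"
  using sum.atLeast_Suc_atMost[of l' m d] sum_mono2[of "{l + 1..m}" "{l'..m}" d]
  by (auto simp: tile_start_def add.commute)

lemma slot_order: "k < k' \<Longrightarrow> k' \<in> {1..n} \<Longrightarrow> slot_start k' + e k' \<le> slot_start k"
  by (subst slot_end) (auto simp: slot_start_def intro!: sum_mono2)

lemma met_fits: "l \<in> {1..m} \<Longrightarrow> k \<in> {1..n} \<Longrightarrow> meets l k \<Longrightarrow> d l \<le> e k"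
  using tile_fits[of l k] slot_end[of k] by (simp add: meets_iff tile_start_def)

text \<open>A slot strictly between two slots met by the same tile would be shorter than the tile.\<close>

lemma met_slots_adjacent:
  assumes "l \<in> {1..m}" "k \<in> {1..n}" "j \<in> {1..n}" "meets l k" "meets l j" "j < k"
  shows "k = j + 1"
proof (rule ccontr)
  assume "k \<noteq> j + 1"
  with assms have "j < k - 1" "k - 1 \<in> {1..n}" by auto
  then have "slot_start k + e k + e (k - 1) \<le> slot_start j"
    using slot_order[of j "k - 1"] slot_start_pred[of k] assms by simp
  moreover have "d l \<le> e (k - 1)"
    using met_fits[of l k] e_decreasing[of "k - 1" k] assms \<open>k - 1 \<in> {1..n}\<close> by auto
  ultimately show False using assms by (auto simp: meets_iff)
qed

lemma slot_total: "k \<in> {1..n} \<Longrightarrow> slot_start k + e k \<le> (\<Sum>j = 1..n. e j)"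
  by (subst slot_end) (auto intro!: sum_mono2)

lemma tile_at:
  assumes "k \<in> {1..n}" "p < e k"
  obtains l where "l \<in> {1..m}" "tile_start l \<le> slot_start k + p"
    "slot_start k + p < tile_start l + d l"
  using position_in_suffix_sums[of "slot_start k + p" d m] slot_total[of k] tiles_cover assms
  unfolding tile_start_def by force

lemma met_slots_of_left_crossing:
  assumes l: "l \<in> {1..m}" and k: "k \<in> {1..n}" and met: "meets l k"
    and left: "tile_start l < slot_start k" and inside: "tile_start l + d l \<le> slot_start k + e k"
  shows "k + 1 \<in> {1..n}" and "{j. j \<in> {1..n} \<and> meets l j} = {k, k + 1}"
proof -
  have "tile_start l < (\<Sum>j = 1..n. e j)" using left slot_total[OF k] by simp
  then obtain j where j: "j \<in> {1..n}" "slot_start j \<le> tile_start l"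
      "tile_start l < slot_start j + e j"
    using position_in_suffix_sums[of "tile_start l" e n] unfolding slot_start_def by auto
  have "meets l j" using j met by (auto simp: meets_iff)
  have "k < j"
    using slot_order[of j k] j k left by (cases j k rule: linorder_cases) auto
  then have jk: "j = k + 1"
    using met_slots_adjacent[OF l j(1) k \<open>meets l j\<close> met] by simp
  with j show "k + 1 \<in> {1..n}" by simp
  have "i = k \<or> i = k + 1" if i: "i \<in> {1..n}" "meets l i" for i
  proof (cases i k rule: linorder_cases)
    case less
    then show ?thesis using slot_order[of i k] k inside i by (auto simp: meets_iff)
  next
    case greater
    then show ?thesis using met_slots_adjacent[OF l i(1) k i(2) met] by simp
  qed simp
  then show "{j. j \<in> {1..n} \<and> meets l j} = {k, k + 1}"
    using k met j(1) \<open>meets l j\<close> unfolding jk by blast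
qed

lemma met_slots_of_right_crossing:
  assumes l: "l \<in> {1..m}" and k: "k \<in> {1..n}" and met: "meets l k"
    and right: "slot_start k + e k < tile_start l + d l"
  shows "{j. j \<in> {1..n} \<and> meets l j} = (if k = 1 then {k} else {k, k - 1})"
proof -
  have "d l \<le> e k" by (rule met_fits[OF l k met])
  have "i = k \<or> i = k - 1" if i: "i \<in> {1..n}" "meets l i" for i
  proof (cases i k rule: linorder_cases)
    case less
    then show ?thesis using met_slots_adjacent[OF l k i(1) met i(2)] by simp
  next
    case greater
    then show ?thesis
      using slot_order[of k i] i right \<open>d l \<le> e k\<close> by (auto simp: meets_iff)
  qed simp
  then have "{j. j \<in> {1..n} \<and> meets l j} \<subseteq> {k, k - 1}" by blast
  moreover have "meets l (k - 1)" if "k \<noteq> 1"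
  proof -
    have "e k \<le> e (k - 1)" using k that by (intro e_decreasing) auto
    then show ?thesis
      using slot_start_pred[OF k] met right by (auto simp: meets_iff)
  qed
  moreover have "k - 1 \<in> {1..n} \<longleftrightarrow> k \<noteq> 1" using k by auto
  ultimately show ?thesis using k met by (cases "k = 1") (simp_all, blast+)
qed

lemma met_slots_of_inside:
  assumes l: "l \<in> {1..m}" and k: "k \<in> {1..n}" and met: "meets l k"
    and "slot_start k \<le> tile_start l" "tile_start l + d l \<le> slot_start k + e k"
  shows "{j. j \<in> {1..n} \<and> meets l j} = {k}"
proof -
  have "i = k" if i: "i \<in> {1..n}" "meets l i" for i
    using slot_order[of i k] slot_order[of k i] i k assms
    by (cases i k rule: linorder_cases) (auto simp: meets_iff)
  with k met show ?thesis by blast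
qed

text \<open>
  The equation of a tile inside a slot says that the entries under it vanish.  Let a tile of length
  \<open>d\<close> cross a boundary between two slots.  Its equations pair the last \<open>d\<close> entries before the
  boundary with the first \<open>d\<close> entries after it, that is, the entries at distance \<open>d\<close>.  An entry
  under the part after the boundary is paired with one to the left of the tile; going from left to
  right, all entries whose tile ends within their slot vanish.  An entry under the part before the
  boundary is paired with one to the right of the tile; going from right to left, these vanish
  too, starting from a tile that sticks out of the last slot, whose equations have a single term.
\<close>

lemma tiling_equations_trivial:
  fixes z :: "nat \<Rightarrow> nat \<Rightarrow> 'a::ab_group_add"
  assumes eq: "\<And>l r. l \<in> {1..m} \<Longrightarrow> r < d l \<Longrightarrow>
      (\<Sum>k | k \<in> {1..n} \<and> meets l k. z k (r + offset l k)) = 0"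
    and "k \<in> {1..n}" "p < e k"
  shows "z k p = 0"
proof -
  \<comment> \<open>entries whose tile does not stick out on the right, by induction on their position \<open>P\<close>\<close>
  have inside: "z k p = 0"
    if "P = slot_start k + p" "k \<in> {1..n}" "p < e k" "l \<in> {1..m}"
      "tile_start l \<le> P" "P < tile_start l + d l"
      "tile_start l + d l \<le> slot_start k + e k" for P k p l
    using that
  proof (induction P arbitrary: k p l rule: less_induct)
    case (less P)
    note k = \<open>k \<in> {1..n}\<close> and l = \<open>l \<in> {1..m}\<close>
    have met: "meets l k" using less.prems by (auto simp: meets_iff)
    show ?case
    proof (cases "slot_start k \<le> tile_start l")
      case True
      have "offset l k = tile_start l - slot_start k"
        using True less.prems by (simp add: offset_def)
      then show ?thesis
        using eq[OF l, of "P - tile_start l"] True less.prems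
        unfolding met_slots_of_inside[OF l k met True less.prems(7)] by auto
    next
      case False
      then have left: "tile_start l < slot_start k" by simp
      note slots = met_slots_of_left_crossing[OF l k met left less.prems(7)]
      have pred: "slot_start k = slot_start (k + 1) + e (k + 1)"
        using slot_start_pred[OF slots(1)] by simp
      have met': "meets l (k + 1)" using slots(2) by auto
      have fits': "d l \<le> e (k + 1)" by (rule met_fits[OF l slots(1) met'])
      \<comment> \<open>the entry of the previous slot at distance \<open>d l\<close> to the left of \<open>P\<close>\<close>
      define p' where "p' = p + e (k + 1) - d l"
      have off: "p + offset l k = p" "p + offset l (k + 1) = p'"
        using left pred fits' less.prems by (auto simp: offset_def p'_def)
      have "p < d l" using less.prems left by simp
      from eq[OF l this] have "z k p + z (k + 1) p' = 0"
        unfolding slots(2) by (simp add: off[simplified])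
      moreover have "z (k + 1) p' = 0"
      proof -
        have p': "p' < e (k + 1)" using less.prems left fits' by (simp add: p'_def)
        obtain l' where l': "l' \<in> {1..m}" "tile_start l' \<le> slot_start (k + 1) + p'"
            "slot_start (k + 1) + p' < tile_start l' + d l'"
          using tile_at[OF slots(1) p'] .
        have "slot_start (k + 1) + p' < tile_start l"
          using less.prems pred fits' by (simp add: p'_def)
        then have "l < l'"
          using l' tile_order[of l' l] l by (cases l l' rule: linorder_cases) auto
        then have "tile_start l' + d l' \<le> slot_start (k + 1) + e (k + 1)"
          using tile_order[of l l'] l' left pred by simp
        moreover have "slot_start (k + 1) + p' < P"
          using less.prems pred fits' by (simp add: p'_def)
        ultimately show ?thesis
          using less.IH[OF _ refl slots(1) p' l'] by simp
      qed
      ultimately show ?thesis by simp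
    qed
  qed
  \<comment> \<open>all entries, by induction on the distance to the end of the last slot\<close>
  show ?thesis using assms(2,3)
  proof (induction "(\<Sum>j = 1..n. e j) - (slot_start k + p)" arbitrary: k p rule: less_induct)
    case less
    note k = \<open>k \<in> {1..n}\<close>
    obtain l where l: "l \<in> {1..m}" "tile_start l \<le> slot_start k + p"
        "slot_start k + p < tile_start l + d l"
      using tile_at[OF k \<open>p < e k\<close>] .
    have met: "meets l k" using less.prems l by (auto simp: meets_iff)
    have fits: "d l \<le> e k" by (rule met_fits[OF l(1) k met])
    show ?case
    proof (cases "tile_start l + d l \<le> slot_start k + e k")
      case True
      then show ?thesis using inside[OF refl k _ l] less.prems by simp
    next
      case False
      then have right: "slot_start k + e k < tile_start l + d l" by simp
      note slots = met_slots_of_right_crossing[OF l(1) k met right]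
      \<comment> \<open>the entry of the next slot at distance \<open>d l\<close> to the right; also the index of the equation\<close>
      define p' where "p' = p + d l - e k"
      have "p' < d l" using less.prems right l(2) by (simp add: p'_def)
      have off: "p' + offset l k = p"
        using right l fits by (simp add: offset_def p'_def)
      show ?thesis
      proof (cases "k = 1")
        case True
        then show ?thesis using eq[OF l(1) \<open>p' < d l\<close>] off unfolding slots by simp
      next
        case False
        have pred: "slot_start (k - 1) = slot_start k + e k" by (rule slot_start_pred[OF k])
        then have off': "offset l (k - 1) = 0" 
          using met by (auto simp: offset_def meets_iff)
        have "k - 1 \<noteq> k" using False k by auto
        then have "z k p + z (k - 1) p' = 0"
          using eq[OF l(1) \<open>p' < d l\<close>] off off' False unfolding slots by simp
        moreover have "z (k - 1) p' = 0"
        proof (rule less.hyps)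
          show k': "k - 1 \<in> {1..n}" using False k by auto
          show p': "p' < e (k - 1)"
            using \<open>p' < d l\<close> fits e_decreasing[of "k - 1" k] k' k by auto
          show "(\<Sum>j = 1..n. e j) - (slot_start (k - 1) + p')
              < (\<Sum>j = 1..n. e j) - (slot_start k + p)"
            using slot_total[OF k'] p' pred met right l(2)
            by (auto simp: p'_def meets_iff)
        qed
        ultimately show ?thesis by simp
      qed
    qed
  qed
qed

end

section \<open>Embedding by windows\<close>

text \<open>
  With \<open>q = c\<close> this serves as the left component of a homomorphism, and with \<open>q l = c l - 1\<close> and the
  same windows as its right component: dropping the first or the last entry of a window of
  length \<open>c l\<close> is what the two structure maps of \<open>J (c l)\<close> do.
\<close>

definition window_map ::
  "nat set \<Rightarrow> (nat \<Rightarrow> nat) \<Rightarrow> (nat \<Rightarrow> nat set) \<Rightarrow> (nat \<Rightarrow> nat \<Rightarrow> nat)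
    \<Rightarrow> (nat \<Rightarrow> nat \<Rightarrow> 'k::field) \<Rightarrow> nat \<Rightarrow> nat \<Rightarrow> 'k" where
  "window_map I q L t x = (\<lambda>l r. if l \<in> I \<and> r < q l then \<Sum>k\<in>L l. x k (r + t l k) else 0)"

lemma linear_window_map:
  "linear_map_on family_scale family_scale V (family_space I q) (window_map I q L t)"
  by (auto simp: linear_map_on_def window_map_def family_space_iff fun_eq_iff sum.distrib
      sum_distrib_left)

lemma first_window_map:
  assumes "\<And>l k. l \<in> I' \<Longrightarrow> k \<in> L l \<Longrightarrow> k \<in> I \<and> t l k + c l \<le> f k"
  shows "first_family I' c (window_map I' c L t x)
    = window_map I' (\<lambda>l. c l - 1) L t (first_family I f x)"
proof (intro ext)
  fix l r
  show "first_family I' c (window_map I' c L t x) l r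
      = window_map I' (\<lambda>l. c l - 1) L t (first_family I f x) l r"
  proof (cases "l \<in> I' \<and> r < c l - 1")
    case True
    then have "r + t l k < f k - 1 \<and> k \<in> I" if "k \<in> L l" for k
      using assms[of l k] that by auto
    with True show ?thesis
      by (auto simp: first_family_def window_map_def intro!: sum.cong)
  next
    case False
    then show ?thesis by (auto simp: first_family_def window_map_def)
  qed
qed

lemma second_window_map:
  assumes "\<And>l k. l \<in> I' \<Longrightarrow> k \<in> L l \<Longrightarrow> k \<in> I \<and> t l k + c l \<le> f k"
  shows "second_family I' c (window_map I' c L t x)
    = window_map I' (\<lambda>l. c l - 1) L t (second_family I f x)"
proof (intro ext)
  fix l r
  show "second_family I' c (window_map I' c L t x) l r
      = window_map I' (\<lambda>l. c l - 1) L t (second_family I f x) l r"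
  proof (cases "l \<in> I' \<and> r < c l - 1")
    case True
    then have "r + t l k < f k - 1 \<and> k \<in> I" if "k \<in> L l" for k
      using assms[of l k] that by auto
    with True show ?thesis
      by (auto simp: second_family_def window_map_def intro!: sum.cong)
  next
    case False
    then show ?thesis by (auto simp: second_family_def window_map_def)
  qed
qed

lemma inj_on_window_map:
  fixes p q :: "nat \<Rightarrow> nat"
  assumes "\<And>z k r. (\<And>l s. l \<in> I' \<Longrightarrow> s < q l \<Longrightarrow> (\<Sum>j\<in>L l. z j (s + t l j)) = (0 :: 'k::field))
      \<Longrightarrow> z \<in> family_space I p \<Longrightarrow> k \<in> I \<Longrightarrow> r < p k \<Longrightarrow> z k r = 0"
  shows "inj_on (window_map I' q L t) (family_space I p :: (nat \<Rightarrow> nat \<Rightarrow> 'k) set)"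
proof (rule inj_onI)
  fix x y :: "nat \<Rightarrow> nat \<Rightarrow> 'k"
  assume x: "x \<in> family_space I p" and y: "y \<in> family_space I p"
    and xy: "window_map I' q L t x = window_map I' q L t y"
  have "(\<Sum>j\<in>L l. (x - y) j (s + t l j)) = 0" if "l \<in> I'" "s < q l" for l s
    using fun_cong[OF fun_cong[OF xy, of l], of s] that
    by (simp add: window_map_def sum_subtractf)
  moreover have "x - y \<in> family_space I p" using x y by (simp add: family_space_iff)
  ultimately have "(x - y) k r = 0" if "k \<in> I" "r < p k" for k r
    using assms[of "x - y" k r] that by blast
  then have "x k r = y k r" for k r
    using x y by (cases "k \<in> I \<and> r < p k") (auto simp: family_space_iff)
  then show "x = y" by (simp add: fun_eq_iff)
qed

text \<open>
  If tile \<open>l\<close> is longer than slot \<open>k\<close>, then all tiles of length at most \<open>f k - 1\<close> come before it, and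
  by the right bound at \<open>k\<close> they already cover everything up to the end of slot \<open>k\<close>.  Hence the
  tiles fit.
\<close>

lemma dimension_bounds_imp_embedding:
  fixes m n :: nat and c f :: "nat \<Rightarrow> nat"
  assumes c_pos: "\<And>i. i \<in> {1..m} \<Longrightarrow> 0 < c i"
    and f_pos: "\<And>j. j \<in> {1..n} \<Longrightarrow> 0 < f j"
    and c_dec: "\<And>i j. 1 \<le> i \<Longrightarrow> i \<le> j \<Longrightarrow> j \<le> m \<Longrightarrow> c j \<le> c i"
    and f_dec: "\<And>i j. 1 \<le> i \<Longrightarrow> i \<le> j \<Longrightarrow> j \<le> n \<Longrightarrow> f j \<le> f i"
    and left: "\<And>k. k \<in> {1..n} \<Longrightarrow>
      (\<Sum>j = k..n. f j) \<le> (\<Sum>l | l \<in> {1..m} \<and> c l \<le> f k. c l)"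
    and right: "\<And>k. k \<in> {1..n} \<Longrightarrow>
      (\<Sum>j = k..n. f j - 1) \<le> (\<Sum>l | l \<in> {1..m} \<and> c l \<le> f k. c l - 1)"
  shows "subrepresentation (direct_sum {1..n} (\<lambda>j. J (f j)))
      (direct_sum {1..m} (\<lambda>i. J (c i)) ::
        ('k::field, nat \<Rightarrow> nat \<Rightarrow> 'k, nat \<Rightarrow> nat \<Rightarrow> 'k) kronecker)"
proof -
  let ?A = "\<lambda>k. {l. l \<in> {1..m} \<and> c l \<le> f k}"
  have later: "?A k \<subseteq> {l + 1..m}" if "l \<in> {1..m}" "\<not> c l \<le> f k" for k l
  proof
    fix l' assume "l' \<in> ?A k"
    then show "l' \<in> {l + 1..m}" using that c_dec[of l' l] by (cases "l < l'") auto
  qed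
  interpret tiling m n "\<lambda>l. c l - 1" "\<lambda>k. f k - 1"
  proof
    show "f j - 1 \<le> f i - 1" if "1 \<le> i" "i \<le> j" "j \<le> n" for i j
      using f_dec[OF that] by simp
    show "c l - 1 \<le> f k - 1" if "l \<in> {1..m}" "k \<in> {1..n}"
        "(\<Sum>j = l + 1..m. c j - 1) < (\<Sum>j = k..n. f j - 1)" for l k
    proof (rule ccontr)
      assume "\<not> c l - 1 \<le> f k - 1"
      then have "(\<Sum>l\<in>?A k. c l - 1) \<le> (\<Sum>j = l + 1..m. c j - 1)"
        using later[of l k] that by (intro sum_mono2) auto
      with right[of k] that show False by simp
    qed
    show "(\<Sum>j = 1..n. f j - 1) \<le> (\<Sum>j = 1..m. c j - 1)"
    proof (cases "n = 0")
      case False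
      have "(\<Sum>l\<in>?A 1. c l - 1) \<le> (\<Sum>j = 1..m. c j - 1)" by (intro sum_mono2) auto
      with right[of 1] False show ?thesis by simp
    qed simp
  qed
  \<comment> \<open>summands \<open>J 1\<close> occupy no slot; match them from the end with the last summands of \<open>M\<close>\<close>
  have ones: "m - (n - k) \<in> {1..m} \<and> c (m - (n - k)) = 1 \<and> n - k < m"
    if k: "k \<in> {1..n}" "f k = 1" for k
  proof -
    have "n - k + 1 = (\<Sum>j = k..n. 1::nat)" using k by (simp add: Suc_diff_le)
    also have "\<dots> \<le> (\<Sum>j = k..n. f j)" using f_pos k by (intro sum_mono) (auto simp: Suc_le_eq)
    also have "\<dots> \<le> (\<Sum>l\<in>?A k. c l)" by (rule left[OF k(1)])
    also have "\<dots> \<le> (\<Sum>l\<in>?A k. 1)" using k by (intro sum_mono) auto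
    finally have *: "n - k + 1 \<le> card (?A k)" by simp
    also have "\<dots> \<le> card {1..m}" by (intro card_mono) auto
    finally have l: "m - (n - k) \<in> {1..m}" "n - k < m" by auto
    have "c (m - (n - k)) \<le> f k"
    proof (rule ccontr)
      assume "\<not> c (m - (n - k)) \<le> f k"
      then have "card (?A k) \<le> card {m - (n - k) + 1..m}"
        using later[OF l(1)] by (intro card_mono) auto
      with * l show False by simp
    qed
    then have "c (m - (n - k)) = 1" using k(2) c_pos[OF l(1)] by linarith
    with l show ?thesis by blast
  qed
  have offset_le: "offset l k \<le> f k - c l" if "0 < c l" for l k
    using that unfolding offset_def by simp
  have no_meet: "\<not> meets l k" if "c l = 1" for l k
    using that unfolding meets_iff by simp
  define L where "L l = {k. k \<in> {1..n} \<and> (meets l k \<or> f k = 1 \<and> l = m - (n - k))}" for l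
  have L_tile: "L l = {k. k \<in> {1..n} \<and> meets l k}" if "l \<in> {1..m}" "c l \<noteq> 1" for l
    using ones that by (auto simp: L_def)
  have L_fits: "k \<in> {1..n} \<and> offset l k + c l \<le> f k" if l: "l \<in> {1..m}" and k: "k \<in> L l" for l k
  proof -
    have kn: "k \<in> {1..n}" using k by (simp add: L_def)
    have "c l \<le> f k"
    proof (cases "meets l k")
      case True
      then show ?thesis using met_fits[OF l kn] c_pos[OF l] f_pos[OF kn] by simp
    next
      case False
      then show ?thesis using ones[OF kn] k by (auto simp: L_def)
    qed
    then show ?thesis using kn offset_le[OF c_pos[OF l], of k] by simp
  qed
  define \<phi> :: "(nat \<Rightarrow> nat \<Rightarrow> 'k) \<Rightarrow> _" where "\<phi> = window_map {1..m} c L offset"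
  define \<psi> :: "(nat \<Rightarrow> nat \<Rightarrow> 'k) \<Rightarrow> _" where
    "\<psi> = window_map {1..m} (\<lambda>l. c l - 1) L offset"
  have trivial: "z k p = 0"
    if z: "\<And>l s. l \<in> {1..m} \<Longrightarrow> s < c l - 1 \<Longrightarrow> (\<Sum>j\<in>L l. z j (s + offset l j)) = 0"
      and k: "k \<in> {1..n}" "p < f k - 1" for z :: "nat \<Rightarrow> nat \<Rightarrow> 'k" and k p
  proof (rule tiling_equations_trivial[OF _ k])
    fix l r assume l: "l \<in> {1..m}" "r < c l - 1"
    then show "(\<Sum>k | k \<in> {1..n} \<and> meets l k. z k (r + offset l k)) = 0"
      using z[OF l] by (simp add: L_tile)
  qed
  have "inj_on \<psi> (family_space {1..n} (\<lambda>k. f k - 1))"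
    unfolding \<psi>_def by (rule inj_on_window_map) (rule trivial)
  moreover have "inj_on \<phi> (family_space {1..n} f)"
    unfolding \<phi>_def
  proof (rule inj_on_window_map)
    fix z :: "nat \<Rightarrow> nat \<Rightarrow> 'k" and k r
    assume z: "\<And>l s. l \<in> {1..m} \<Longrightarrow> s < c l \<Longrightarrow> (\<Sum>j\<in>L l. z j (s + offset l j)) = 0"
      and k: "k \<in> {1..n}" "r < f k"
    show "z k r = 0"
    proof (cases "f k = 1")
      case True
      let ?l = "m - (n - k)"
      have l: "?l \<in> {1..m}" "c ?l = 1" "n - k < m" using ones[OF k(1) True] by auto
      have "L ?l = {k}"
      proof -
        have "j = k" if "j \<in> {1..n}" "f j = 1" "?l = m - (n - j)" for j
          using that l k ones[of j] by auto
        then show ?thesis using True k no_meet[OF l(2)] unfolding L_def by blast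
      qed
      then show ?thesis
        using z[OF l(1), of 0] l(2) k True offset_le[of ?l k] by simp
    next
      case False
      show ?thesis
      proof (cases "r < f k - 1")
        case True
        then show ?thesis using trivial[OF z k(1)] by simp
      next
        case r: False
        \<comment> \<open>the last entry survives the second structure map, which shifts by one position\<close>
        have "z k (r - 1 + 1) = 0"
        proof (rule trivial[of "\<lambda>j s. z j (s + 1)"])
          show "(\<Sum>j\<in>L l. z j (s + offset l j + 1)) = 0"
            if "l \<in> {1..m}" "s < c l - 1" for l s
            using z[of l "s + 1"] that by simp
        qed (use k False r in auto)
        then show ?thesis using False k r by simp
      qed
    qed
  qed
  moreover have "first_family {1..m} c (\<phi> x) = \<psi> (first_family {1..n} f x)"
      "second_family {1..m} c (\<phi> x) = \<psi> (second_family {1..n} f x)" for x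
    unfolding \<phi>_def \<psi>_def
    by (rule first_window_map[OF L_fits] second_window_map[OF L_fits]; assumption)+
  ultimately show ?thesis
    unfolding subrepresentation_direct_sum_J
    by (intro exI[of _ \<phi>] exI[of _ \<psi>]) (simp add: \<phi>_def \<psi>_def linear_window_map)
qed


section \<open>The numerical criterion\<close>

lemma max0_ge: "finite A \<Longrightarrow> x \<in> A \<Longrightarrow> x \<le> max0 A"
  by (simp add: max0_def)

lemma max0_mem: "finite A \<Longrightarrow> 0 < max0 A \<Longrightarrow> max0 A \<in> A"
  unfolding max0_def using Max_in[of "insert 0 A"] by auto

lemma max0_le: "(\<And>x. x \<in> A \<Longrightarrow> x \<le> k) \<Longrightarrow> finite A \<Longrightarrow> max0 A \<le> k"
  by (simp add: max0_def)

text \<open>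
  For \<open>k = v i + 1\<close> the summands with \<open>c l \<le> f k\<close> are those with \<open>u (i + 1) < l\<close>, by definition of
  \<open>u\<close>; by definition of \<open>v\<close>, all of these remain available up to \<open>k = v (i + 1)\<close>.  If
  \<open>v (w - 1) < n\<close>, then \<open>u w = m\<close> means that nothing is available for \<open>k = v (w - 1) + 1\<close>, against
  \<open>0 < f k\<close>.
\<close>

lemma index_conditions_iff_dimension_bounds:
  fixes m n :: nat and c f :: "nat \<Rightarrow> nat"
  defines "u \<equiv> u_index m c n f" and "v \<equiv> v_index m c n f" and "w \<equiv> w_index m c n f"
  assumes c_pos: "\<forall>i\<in>{1..m}. 0 < c i"
    and f_pos: "\<forall>j\<in>{1..n}. 0 < f j"
    and c_dec: "\<And>i j. 1 \<le> i \<Longrightarrow> i \<le> j \<Longrightarrow> j \<le> m \<Longrightarrow> c j \<le> c i"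
    and f_dec: "\<And>i j. 1 \<le> i \<Longrightarrow> i \<le> j \<Longrightarrow> j \<le> n \<Longrightarrow> f j \<le> f i"
  shows "(v (w - 1) = n \<and> v w = n \<and>
    (\<forall>i. i + 2 \<le> w \<longrightarrow>
      (\<Sum>j = v i + 1..v (w - 1). f j) \<le> (\<Sum>j = u (i + 1) + 1..u w. c j) \<and>
      (\<Sum>j = v i + 1..v (w - 1). (f j - 1)) \<le> (\<Sum>j = u (i + 1) + 1..u w. (c j - 1))))
    \<longleftrightarrow> (\<forall>k\<in>{1..n}.
      (\<Sum>j = k..n. f j) \<le> (\<Sum>l | l \<in> {1..m} \<and> c l \<le> f k. c l) \<and>
      (\<Sum>j = k..n. f j - 1) \<le> (\<Sum>l | l \<in> {1..m} \<and> c l \<le> f k. c l - 1))"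
    (is "?idx \<longleftrightarrow> ?bounds")
proof -
  let ?A = "\<lambda>k. {l. l \<in> {1..m} \<and> c l \<le> f k}"
  have w: "1 \<le> w" "u w = m"
    using LeastI_ex[OF w_index_exists[OF c_pos, of n f]] by (auto simp: w_def w_index_def u_def)
  have u_Suc: "u (i + 1) = next_u m c n f (v i)" for i by (simp add: u_def v_def u_index_def)
  have v_Suc: "v (i + 1) = next_v m c n f (u (i + 1))" for i
    by (simp add: u_def v_def u_index_def)
  have v_le: "v i \<le> n" for i
    by (cases i) (auto simp: v_def next_v_def intro!: max0_le)
  have A_eq: "?A (v i + 1) = {u (i + 1) + 1..m}" if "v i < n" for i
  proof -
    let ?B = "{j \<in> {1..m}. c j > f (v i + 1)}"
    have u_eq: "u (i + 1) = max0 ?B" using that u_Suc[of i] by (simp add: next_u_def extend0_def)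
    have "l \<le> max0 ?B" if "l \<in> {1..m}" "\<not> c l \<le> f (v i + 1)" for l
      using that by (intro max0_ge) auto
    moreover have "\<not> l \<le> max0 ?B" if "l \<in> {1..m}" "c l \<le> f (v i + 1)" for l
      using max0_mem[of ?B] c_dec[of l "max0 ?B"] that by force
    ultimately have "c l \<le> f (v i + 1) \<longleftrightarrow> max0 ?B + 1 \<le> l" if "l \<in> {1..m}" for l
      using that by (metis not_le Suc_eq_plus1 Suc_le_eq)
    then show ?thesis unfolding u_eq by fastforce
  qed
  have A_sup: "{u (i + 1) + 1..m} \<subseteq> ?A k" if k: "1 \<le> k" "k \<le> v (i + 1)" for i k
  proof
    fix l assume l: "l \<in> {u (i + 1) + 1..m}"
    let ?B = "{j \<in> {1..n}. extend0 m c (u (i + 1) + 1) \<le> f j}"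
    have "v (i + 1) = max0 ?B" unfolding v_Suc next_v_def ..
    with max0_mem[of ?B] k have "v (i + 1) \<in> ?B" by auto
    then have "c (u (i + 1) + 1) \<le> f (v (i + 1))" using l by (simp add: extend0_def)
    moreover have "c l \<le> c (u (i + 1) + 1)" using l by (intro c_dec) auto
    moreover have "f (v (i + 1)) \<le> f k" using k v_le by (intro f_dec)
    ultimately show "l \<in> ?A k" using l by auto
  qed
  show ?thesis
  proof
    assume idx: ?idx
    show ?bounds
    proof
      fix k assume k: "k \<in> {1..n}"
      \<comment> \<open>\<open>k\<close> lies in the block from \<open>v i + 1\<close> to \<open>v i'\<close> with \<open>i' = i + 1\<close>\<close>
      define i' where "i' = (LEAST i. k \<le> v i)"
      have ex: "k \<le> v (w - 1)" using idx k by simp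
      have i': "k \<le> v i'" "i' \<le> w - 1"
        unfolding i'_def by (rule LeastI[of _ "w - 1"], rule ex) (rule Least_le, rule ex)
      have "i' \<noteq> 0" using i' k by (intro notI) (auto simp: v_def)
      then obtain i where i: "i' = i + 1" by (metis Suc_eq_plus1 not0_implies_Suc)
      have "v i < k" using not_less_Least[of i "\<lambda>i. k \<le> v i"] i i'_def by simp
      then have sub: "{k..n} \<subseteq> {v i + 1..n}" by auto
      have "i + 2 \<le> w" using i i' \<open>1 \<le> w\<close> by simp
      with idx w have b: "(\<Sum>j = v i + 1..n. f j) \<le> (\<Sum>j = u (i + 1) + 1..m. c j)"
          "(\<Sum>j = v i + 1..n. f j - 1) \<le> (\<Sum>j = u (i + 1) + 1..m. c j - 1)" by auto
      have "{u (i + 1) + 1..m} \<subseteq> ?A k" using k i i' by (intro A_sup) auto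
      then have R: "(\<Sum>j = u (i + 1) + 1..m. g j) \<le> (\<Sum>l\<in>?A k. g l)" for g :: "nat \<Rightarrow> nat"
        by (intro sum_mono2) auto
      have "(\<Sum>j = k..n. g j) \<le> (\<Sum>j = v i + 1..n. g j)" for g :: "nat \<Rightarrow> nat"
        using sub by (intro sum_mono2) auto
      with b R show "(\<Sum>j = k..n. f j) \<le> (\<Sum>l\<in>?A k. c l) \<and>
          (\<Sum>j = k..n. f j - 1) \<le> (\<Sum>l\<in>?A k. c l - 1)"
        by (meson order_trans)
    qed
  next
    assume bounds: ?bounds
    have "v (w - 1) = n"
    proof (rule ccontr)
      assume "v (w - 1) \<noteq> n"
      then have less: "v (w - 1) < n" using v_le[of "w - 1"] by simp
      then have empty: "?A (v (w - 1) + 1) = {}" using A_eq[OF less] w by simp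
      have "v (w - 1) + 1 \<in> {1..n}" using less by simp
      then have "(\<Sum>j = v (w - 1) + 1..n. f j) \<le> (\<Sum>l\<in>?A (v (w - 1) + 1). c l)"
        using bounds by blast
      then have "f n = 0" using less unfolding empty by auto
      moreover have "n \<in> {1..n}" using less by simp
      ultimately show False using f_pos by (metis less_irrefl)
    qed
    moreover have "v w = n"
    proof -
      have "{i \<in> {1..n}. extend0 m c (m + 1) \<le> f i} = {1..n}" by (auto simp: extend0_def)
      then have "v w = max0 {1..n}"
        using v_Suc[of "w - 1"] w by (simp only: next_v_def le_add_diff_inverse2)
      then show ?thesis
        using max0_ge[of "{1..n}" n] v_le[of w] by (cases "n = 0") auto
    qed
    moreover have "(\<Sum>j = v i + 1..n. f j) \<le> (\<Sum>j = u (i + 1) + 1..m. c j) \<and>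
      (\<Sum>j = v i + 1..n. f j - 1) \<le> (\<Sum>j = u (i + 1) + 1..m. c j - 1)" for i
    proof (cases "v i < n")
      case True
      then have "v i + 1 \<in> {1..n}" by auto
      with bounds have "(\<Sum>j = v i + 1..n. f j) \<le> (\<Sum>l\<in>?A (v i + 1). c l) \<and>
          (\<Sum>j = v i + 1..n. f j - 1) \<le> (\<Sum>l\<in>?A (v i + 1). c l - 1)" by blast
      then show ?thesis unfolding A_eq[OF True] .
    qed auto
    ultimately show ?idx using w by simp
  qed
qed

theorem theorem9:
  fixes m n w :: nat and c f u v :: "nat \<Rightarrow> nat"
    and M N :: "('k::alg_closed_field, nat \<Rightarrow> nat \<Rightarrow> 'k, nat \<Rightarrow> nat \<Rightarrow> 'k) kronecker"
  assumes c_pos: "\<forall>i\<in>{1..m}. 0 < c i"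
    and f_pos: "\<forall>j\<in>{1..n}. 0 < f j"
    and c_decreasing: "\<forall>i j. 1 \<le> i \<longrightarrow> i \<le> j \<longrightarrow> j \<le> m \<longrightarrow> c j \<le> c i"
    and f_decreasing: "\<forall>i j. 1 \<le> i \<longrightarrow> i \<le> j \<longrightarrow> j \<le> n \<longrightarrow> f j \<le> f i"
    and M: "M = direct_sum {1..m} (\<lambda>i. J (c i))"
    and N: "N = direct_sum {1..n} (\<lambda>j. J (f j))"
    and u: "u = u_index m c n f"
    and v: "v = v_index m c n f"
    and w: "w = w_index m c n f"
  shows "subrepresentation N M \<longleftrightarrow>
    v (w - 1) = n \<and> v w = n \<and>
    (\<forall>i. i + 2 \<le> w \<longrightarrow>
      (\<Sum>j = v i + 1..v (w - 1). f j) \<le> (\<Sum>j = u (i + 1) + 1..u w. c j) \<and>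
      (\<Sum>j = v i + 1..v (w - 1). (f j - 1)) \<le> (\<Sum>j = u (i + 1) + 1..u w. (c j - 1)))"
proof -
  let ?bounds = "\<forall>k\<in>{1..n}.
      (\<Sum>j = k..n. f j) \<le> (\<Sum>l | l \<in> {1..m} \<and> c l \<le> f k. c l) \<and>
      (\<Sum>j = k..n. f j - 1) \<le> (\<Sum>l | l \<in> {1..m} \<and> c l \<le> f k. c l - 1)"
  have "subrepresentation N M \<longleftrightarrow> ?bounds"
  proof
    assume "subrepresentation N M"
    then show ?bounds
      unfolding M N using embedding_imp_dimension_bounds f_decreasing by blast
  next
    assume ?bounds
    then show "subrepresentation N M"
      unfolding M N using c_pos f_pos c_decreasing f_decreasing
      by (intro dimension_bounds_imp_embedding) auto
  qed
  also have "?bounds \<longleftrightarrow> v (w - 1) = n \<and> v w = n \<and>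
    (\<forall>i. i + 2 \<le> w \<longrightarrow>
      (\<Sum>j = v i + 1..v (w - 1). f j) \<le> (\<Sum>j = u (i + 1) + 1..u w. c j) \<and>
      (\<Sum>j = v i + 1..v (w - 1). (f j - 1)) \<le> (\<Sum>j = u (i + 1) + 1..u w. (c j - 1)))"
    unfolding u v w
    using index_conditions_iff_dimension_bounds[OF c_pos f_pos] c_decreasing f_decreasing
    by blast
  finally show ?thesis .
qed

end
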